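(* Let $X$ and $A$ be $V$-graphs with chosen unit arrows $1_x( * )\subset X(x;x)$, $1_a( * )\subset A(a;a)$, and let $Y$ be a $V$-graph with chosen contact arrows mappings $\circ:Y(x;y)\,\square\,Y(y;z)\to Y(x;z)$, allowing preevaluation mappings $Y(\phi_0(a);\psi_0(a))\,\square\,\psi_{a,b}(A(a;b))\to Y(\phi_0(a);\psi_0(b))$ or postevaluation mappings $\phi_{a,b}(A(a;b))\,\square\,Y(\phi_0(b);\psi_0(b))\to Y(\phi_0(a);\psi_0(b))$. Let $\Phi:X\,\square\,A\Rightarrow Y$ be a $V$-graphs transport such that for all $x,y\in X_0$, $a,b\in A_0$, as mappings $X(x;y)\,\square\,A(a;b)\to Y(\Phi_0(x,a);\Phi_0(y,b))$, $$\Phi_{\langle x,a\rangle,\langle x,b\rangle}(1_x( * )\,\square\,A(a;b))\circ\Phi_{\langle x,b\rangle,\langle y,b\rangle}(X(x;y)\,\square\,1_b( * ))\ \ge\ \Phi_{\langle x,a\rangle,\langle y,a\rangle}(X(x;y)\,\square\,1_a( * ))\circ\Phi_{\langle y,a\rangle,\langle y,b\rangle}(1_y( * )\,\square\,A(a;b)).$$ Then the name $\Psi:X\Rightarrow Y^A$ of $\Phi$ is a $V$-graphs transport corestricted in the exponential space of continuous transforms $Y_+^{(A)}\subset Y^A$. The prerealization of $\Psi$ is given by the precontact arrows mappings $$X(x;y)\,\square\,A(a;b)\to\Phi_{\langle x,a\rangle,\langle y,a\rangle}(X(x;y)\,\square\,1_a( * ))\circ\Phi_{\langle y,a\rangle,\langle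 y,b\rangle}(1_y( * )\,\square\,A(a;b))$$ and the postrealization by the postcontact arrows mappings $$X(x;y)\,\square\,A(a;b)\to\Phi_{\langle x,a\rangle,\langle x,b\rangle}(1_x( * )\,\square\,A(a;b))\circ\Phi_{\langle x,b\rangle,\langle y,b\rangle}(X(x;y)\,\square\,1_b( * )).$$ If the name is corestricted in the exponential space of natural transforms $Y^{(A)}$, then both realizations coincide; and this common realization coincides with $\Phi$ if moreover $$\Phi_{\langle x,a\rangle,\langle x,b\rangle}(1_x( * )\,\square\,A(a;b))\circ\Phi_{\langle x,b\rangle,\langle y,b\rangle}(X(x;y)\,\square\,1_b( * ))\ \ge\ \Phi_{\langle x,a\rangle,\langle y,b\rangle}(X(x;y)\,\square\,A(a;b))\ \ge\ \Phi_{\langle x,a\rangle,\langle y,a\rangle}(X(x;y)\,\square\,1_a( * ))\circ\Phi_{\langle y,a\rangle,\langle y,b\rangle}(1_y( * )\,\square\,A(a;b)).$$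
   Context: $V$ is a category with the products used below, a final object $*$, and a bifunctor $\square:V\times V\to V$ (a "biproduct", not a categorical one) for which $*$ is neutral, $*\,\square\,r\cong r\cong r\,\square\,*$, and which admits an interchange $r\,\square\,s\cong s\,\square\,r$. (In the paper $\square$ is a second biproduct, a relator for a first one $\otimes$ with the same neutral object and comparison arrows $r\otimes s\to r\,\square\,s$.) Each set $V(r;s)$ of arrows ("mappings") carries a partial order $\ge$ with respect to which composition and $\square$ are monotone. A $V$-graph $X$ is a set $X_0$ with objects $X(x;y)\in V$; a $V$-graphs transport $f:X\Rightarrow Y$ is a map $f_0:X_0\to Y_0$ with mappings $f_{x,y}:X(x;y)\to Y(f_0(x);f_0(y))$. Unit arrows $1_x:*\to X(x;x)$ and contact arrows mappings satisfy no law. $X\,\square\,A$ has vertexes $X_0\times A_0$ and edges $X(x;y)\,\square\,A(a;b)$. Notation such as $\Phi(X(x;y)\,\square\,1_a( * ))$ and $P\circ Q$ denotes the evident composite mapping with the contact arrows mapping (inserting $X(x;y)\cong X(x;y)\,\square\,*$ and, when factors occur in opposite order, the interchange). $Y^A$ has as vertexes the transports $\phi:A\Rightarrow Y$ and edges $Y^A(\phi;\psi)=\prod_{a\in A_0}Y(\phi_0(a);\psi_0(a))$. The name $\Psi$ of $\Phi$: $\Psi_0(x):A\Rightarrow Y$ sends $a\mapsto\Phi_0(x,a)$ with edge mappings $A(a;b)\to\Phi_{\langle x,a\rangle,\langle x,b\rangle}(1_x( * )\,\square\,A(a;b))$, and $\Psi_{x,y}$ has $a$-component $X(x;y)\to\Phi_{\langle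 x,a\rangle,\langle y,a\rangle}(X(x;y)\,\square\,1_a( * ))$. The prerealization of $\Psi:X\Rightarrow Y^A$ has edge mappings $X(x;y)\,\square\,A(a;b)\to\Psi_{x,y}(X(x;y))_a\circ\Psi_0(y)_{a,b}(A(a;b))$, the postrealization $X(x;y)\,\square\,A(a;b)\to\Psi_0(x)_{a,b}(A(a;b))\circ\Psi_{x,y}(X(x;y))_b$. $\Psi$ is corestricted in the space of continuous transforms $Y_+^{(A)}$ if for all $x,y,a,b$ the second (post) mapping is $\ge$ the first (pre) mapping, and in the space of natural transforms $Y^{(A)}$ if the two are equal. *)

theory Defs
  imports "HOL-Library.FuncSet"
begin

record ('o, 'm) box_cat =
  Ob    :: "'o set"
  Ar    :: "'m set"
  Dm    :: "'m \<Rightarrow> 'o"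
  Cd    :: "'m \<Rightarrow> 'o"
  Ident :: "'o \<Rightarrow> 'm"
  Cmp   :: "'m \<Rightarrow> 'm \<Rightarrow> 'm"      (infixl "\<cdot>\<index>" 75)
  Geq   :: "'m \<Rightarrow> 'm \<Rightarrow> bool"    (infix "\<succeq>\<index>" 50)
  Star  :: "'o"                (\<open>\<star>\<index>\<close>)
  BoxO  :: "'o \<Rightarrow> 'o \<Rightarrow> 'o"      (infixr "\<box>\<index>" 80)
  BoxA  :: "'m \<Rightarrow> 'm \<Rightarrow> 'm"      (infixr "\<boxtimes>\<index>" 80)
  Lins  :: "'o \<Rightarrow> 'm"
  Rins  :: "'o \<Rightarrow> 'm"
  Swap  :: "'o \<Rightarrow> 'o \<Rightarrow> 'm"

text \<open>The composition \<open>g \<cdot> f\<close> is read from right to left.\<close>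

definition hom :: "('o, 'm) box_cat \<Rightarrow> 'o \<Rightarrow> 'o \<Rightarrow> 'm set" where
  "hom V r s = {f \<in> Ar V. Dm V f = r \<and> Cd V f = s}"

definition iso :: "('o, 'm) box_cat \<Rightarrow> 'o \<Rightarrow> 'o \<Rightarrow> 'm \<Rightarrow> bool" where
  "iso V r s f \<longleftrightarrow> f \<in> hom V r s \<and>
     (\<exists>g \<in> hom V s r. Cmp V g f = Ident V r \<and> Cmp V f g = Ident V s)"

locale category =
  fixes V :: "('o, 'm) box_cat" (structure)
  assumes Dm_Ob: "f \<in> Ar V \<Longrightarrow> Dm V f \<in> Ob V"
    and Cd_Ob: "f \<in> Ar V \<Longrightarrow> Cd V f \<in> Ob V"
    and Ident_hom: "r \<in> Ob V \<Longrightarrow> Ident V r \<in> hom V r r"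
    and Cmp_hom: "\<lbrakk>f \<in> hom V r s; g \<in> hom V s t\<rbrakk> \<Longrightarrow> g \<cdot> f \<in> hom V r t"
    and Cmp_Ident_right: "f \<in> hom V r s \<Longrightarrow> f \<cdot> Ident V r = f"
    and Cmp_Ident_left: "f \<in> hom V r s \<Longrightarrow> Ident V s \<cdot> f = f"
    and Cmp_assoc: "\<lbrakk>f \<in> hom V r s; g \<in> hom V s t; h \<in> hom V t w\<rbrakk>
          \<Longrightarrow> (h \<cdot> g) \<cdot> f = h \<cdot> (g \<cdot> f)"

text \<open>
  \<open>Lins\<close>, \<open>Rins\<close> and \<open>Swap\<close> are the isomorphisms \<open>r \<rightarrow> \<star> \<box> r\<close>,
  \<open>r \<rightarrow> r \<box> \<star>\<close> and \<open>r \<box> s \<rightarrow> s \<box> r\<close>.  They are natural; no associativity of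
  \<open>\<box>\<close> and no coherence law is imposed.
\<close>

locale ordered_box_category = category V for V :: "('o, 'm) box_cat" (structure) +
  assumes Star_Ob: "\<star> \<in> Ob V"
    and Star_final: "r \<in> Ob V \<Longrightarrow> \<exists>!f. f \<in> hom V r \<star>"
    and BoxO_Ob: "\<lbrakk>r \<in> Ob V; s \<in> Ob V\<rbrakk> \<Longrightarrow> r \<box> s \<in> Ob V"
    and BoxA_hom: "\<lbrakk>f \<in> hom V r s; g \<in> hom V r' s'\<rbrakk>
          \<Longrightarrow> f \<boxtimes> g \<in> hom V (r \<box> r') (s \<box> s')"
    and BoxA_Ident: "\<lbrakk>r \<in> Ob V; s \<in> Ob V\<rbrakk>
          \<Longrightarrow> Ident V r \<boxtimes> Ident V s = Ident V (r \<box> s)"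
    and BoxA_Cmp: "\<lbrakk>f \<in> hom V r s; g \<in> hom V s t; f' \<in> hom V r' s'; g' \<in> hom V s' t'\<rbrakk>
          \<Longrightarrow> (g \<cdot> f) \<boxtimes> (g' \<cdot> f') = (g \<boxtimes> g') \<cdot> (f \<boxtimes> f')"
    and Lins_iso: "r \<in> Ob V \<Longrightarrow> iso V r (\<star> \<box> r) (Lins V r)"
    and Lins_natural: "f \<in> hom V r s
          \<Longrightarrow> Lins V s \<cdot> f = (Ident V \<star> \<boxtimes> f) \<cdot> Lins V r"
    and Rins_iso: "r \<in> Ob V \<Longrightarrow> iso V r (r \<box> \<star>) (Rins V r)"
    and Rins_natural: "f \<in> hom V r s
          \<Longrightarrow> Rins V s \<cdot> f = (f \<boxtimes> Ident V \<star>) \<cdot> Rins V r"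
    and Swap_iso: "\<lbrakk>r \<in> Ob V; s \<in> Ob V\<rbrakk> \<Longrightarrow> iso V (r \<box> s) (s \<box> r) (Swap V r s)"
    and Swap_natural: "\<lbrakk>f \<in> hom V r s; f' \<in> hom V r' s'\<rbrakk>
          \<Longrightarrow> Swap V s s' \<cdot> (f \<boxtimes> f') = (f' \<boxtimes> f) \<cdot> Swap V r r'"
    and Geq_partial_order: "\<lbrakk>r \<in> Ob V; s \<in> Ob V\<rbrakk>
          \<Longrightarrow> partial_order_on (hom V r s) {(f, g). f \<in> hom V r s \<and> g \<in> hom V r s \<and> g \<succeq> f}"
    and Cmp_mono: "\<lbrakk>f \<in> hom V r s; f' \<in> hom V r s; g \<in> hom V s t; g' \<in> hom V s t;
          f \<succeq> f'; g \<succeq> g'\<rbrakk> \<Longrightarrow> g \<cdot> f \<succeq> g' \<cdot> f'"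
    and BoxA_mono: "\<lbrakk>f \<in> hom V r s; f' \<in> hom V r s; g \<in> hom V t w; g' \<in> hom V t w;
          f \<succeq> f'; g \<succeq> g'\<rbrakk> \<Longrightarrow> f \<boxtimes> g \<succeq> f' \<boxtimes> g'"

definition is_product ::
  "('o, 'm) box_cat \<Rightarrow> 'i set \<Rightarrow> ('i \<Rightarrow> 'o) \<Rightarrow> 'o \<Rightarrow> ('i \<Rightarrow> 'm) \<Rightarrow> bool" where
  "is_product V I r p \<pi> \<longleftrightarrow> p \<in> Ob V \<and> (\<forall>i\<in>I. \<pi> i \<in> hom V p (r i)) \<and>
     (\<forall>q\<in>Ob V. \<forall>f. (\<forall>i\<in>I. f i \<in> hom V q (r i)) \<longrightarrow>
        (\<exists>!h. h \<in> hom V q p \<and> (\<forall>i\<in>I. Cmp V (\<pi> i) h = f i)))"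

text \<open>A choice of a product object and of projections for families of objects.\<close>

record ('i, 'o, 'm) product_choice =
  Pobj :: "('i \<Rightarrow> 'o) \<Rightarrow> 'o"
  Pproj :: "('i \<Rightarrow> 'o) \<Rightarrow> 'i \<Rightarrow> 'm"

record ('x, 'o) vgraph =
  Vert :: "'x set"
  Edge :: "'x \<Rightarrow> 'x \<Rightarrow> 'o"

definition is_vgraph :: "('o, 'm) box_cat \<Rightarrow> ('x, 'o) vgraph \<Rightarrow> bool" where
  "is_vgraph V X \<longleftrightarrow> (\<forall>x\<in>Vert X. \<forall>y\<in>Vert X. Edge X x y \<in> Ob V)"

definition unit_arrows ::
  "('o, 'm) box_cat \<Rightarrow> ('x, 'o) vgraph \<Rightarrow> ('x \<Rightarrow> 'm) \<Rightarrow> bool" where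
  "unit_arrows V X u \<longleftrightarrow> (\<forall>x\<in>Vert X. u x \<in> hom V (Star V) (Edge X x x))"

definition contact_arrows ::
  "('o, 'm) box_cat \<Rightarrow> ('y, 'o) vgraph \<Rightarrow> ('y \<Rightarrow> 'y \<Rightarrow> 'y \<Rightarrow> 'm) \<Rightarrow> bool" where
  "contact_arrows V Y c \<longleftrightarrow> (\<forall>x\<in>Vert Y. \<forall>y\<in>Vert Y. \<forall>z\<in>Vert Y.
     c x y z \<in> hom V (BoxO V (Edge Y x y) (Edge Y y z)) (Edge Y x z))"

text \<open>
  Transports are extensional functions, so that equality of records is equality of
  transports, and the transports between two graphs form the correct set.
\<close>

record ('x, 'y, 'm) transport =
  vmap :: "'x \<Rightarrow> 'y"
  emap :: "'x \<times> 'x \<Rightarrow> 'm"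

definition is_transport ::
  "('o, 'm) box_cat \<Rightarrow> ('x, 'o) vgraph \<Rightarrow> ('y, 'o) vgraph \<Rightarrow> ('x, 'y, 'm) transport \<Rightarrow> bool" where
  "is_transport V X Y f \<longleftrightarrow>
     vmap f \<in> Vert X \<rightarrow>\<^sub>E Vert Y \<and>
     emap f \<in> (\<Pi>\<^sub>E (x, y) \<in> Vert X \<times> Vert X. hom V (Edge X x y) (Edge Y (vmap f x) (vmap f y)))"

definition box_graph ::
  "('o, 'm) box_cat \<Rightarrow> ('x, 'o) vgraph \<Rightarrow> ('a, 'o) vgraph \<Rightarrow> ('x \<times> 'a, 'o) vgraph" where
  "box_graph V X A = \<lparr>Vert = Vert X \<times> Vert A,
     Edge = (\<lambda>(x, a) (y, b). BoxO V (Edge X x y) (Edge A a b))\<rparr>"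

definition edge_family ::
  "('a, 'o) vgraph \<Rightarrow> ('y, 'o) vgraph \<Rightarrow> ('a, 'y, 'm) transport \<Rightarrow> ('a, 'y, 'm) transport
    \<Rightarrow> 'a \<Rightarrow> 'o" where
  "edge_family A Y \<phi> \<psi> = (\<lambda>a\<in>Vert A. Edge Y (vmap \<phi> a) (vmap \<psi> a))"

definition exp_graph ::
  "('o, 'm) box_cat \<Rightarrow> ('a, 'o, 'm) product_choice \<Rightarrow> ('a, 'o) vgraph \<Rightarrow> ('y, 'o) vgraph
    \<Rightarrow> (('a, 'y, 'm) transport, 'o) vgraph" where
  "exp_graph V P A Y = \<lparr>Vert = {\<phi>. is_transport V A Y \<phi>},
     Edge = (\<lambda>\<phi> \<psi>. Pobj P (edge_family A Y \<phi> \<psi>))\<rparr>"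

text \<open>Precisely the products occurring as edges of the graph \<open>Y\<^sup>A\<close> are required.\<close>

definition has_exp_products ::
  "('o, 'm) box_cat \<Rightarrow> ('a, 'o, 'm) product_choice \<Rightarrow> ('a, 'o) vgraph \<Rightarrow> ('y, 'o) vgraph \<Rightarrow> bool" where
  "has_exp_products V P A Y \<longleftrightarrow> (\<forall>\<phi> \<psi>. is_transport V A Y \<phi> \<longrightarrow> is_transport V A Y \<psi> \<longrightarrow>
     is_product V (Vert A) (edge_family A Y \<phi> \<psi>)
       (Pobj P (edge_family A Y \<phi> \<psi>)) (Pproj P (edge_family A Y \<phi> \<psi>)))"

text \<open>
  The composite \<open>P \<circ> Q\<close> of \<open>P : r \<rightarrow> Y(k;l)\<close> and \<open>Q : s \<rightarrow> Y(l;m)\<close> with the contact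
  mapping \<open>c\<close>.  On \<open>r \<box> s\<close> it is \<open>contact_direct\<close>; on \<open>s \<box> r\<close>, where the factors occur in
  the opposite order, it is \<open>contact_crossed\<close>.
\<close>

definition contact_direct :: "('o, 'm) box_cat \<Rightarrow> 'm \<Rightarrow> 'm \<Rightarrow> 'm \<Rightarrow> 'm" where
  "contact_direct V c p q = Cmp V c (BoxA V p q)"

definition contact_crossed :: "('o, 'm) box_cat \<Rightarrow> 'm \<Rightarrow> 'm \<Rightarrow> 'm \<Rightarrow> 'm" where
  "contact_crossed V c p q = Cmp V (Cmp V c (BoxA V p q)) (Swap V (Dm V q) (Dm V p))"

text \<open>
  With \<open>v\<close> the unit arrows of \<open>A\<close> and \<open>u\<close> those of \<open>X\<close>, the next two are
  \<open>\<Phi>(X(x;y) \<box> 1\<^sub>a(\<star>)) : X(x;y) \<rightarrow> Y(\<Phi>\<^sub>0(x,a); \<Phi>\<^sub>0(y,a))\<close> and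
  \<open>\<Phi>(1\<^sub>x(\<star>) \<box> A(a;b)) : A(a;b) \<rightarrow> Y(\<Phi>\<^sub>0(x,a); \<Phi>\<^sub>0(x,b))\<close>.
\<close>

definition along_left ::
  "('o, 'm) box_cat \<Rightarrow> ('x, 'o) vgraph \<Rightarrow> ('a \<Rightarrow> 'm) \<Rightarrow> ('x \<times> 'a, 'y, 'm) transport
    \<Rightarrow> 'x \<Rightarrow> 'x \<Rightarrow> 'a \<Rightarrow> 'm" where
  "along_left V X v \<Phi> x y a =
     Cmp V (Cmp V (emap \<Phi> ((x, a), (y, a))) (BoxA V (Ident V (Edge X x y)) (v a)))
       (Rins V (Edge X x y))"

definition along_right ::
  "('o, 'm) box_cat \<Rightarrow> ('a, 'o) vgraph \<Rightarrow> ('x \<Rightarrow> 'm) \<Rightarrow> ('x \<times> 'a, 'y, 'm) transport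
    \<Rightarrow> 'x \<Rightarrow> 'a \<Rightarrow> 'a \<Rightarrow> 'm" where
  "along_right V A u \<Phi> x a b =
     Cmp V (Cmp V (emap \<Phi> ((x, a), (x, b))) (BoxA V (u x) (Ident V (Edge A a b))))
       (Lins V (Edge A a b))"

text \<open>The mappings \<open>X(x;y) \<box> A(a;b) \<rightarrow> Y(\<Phi>\<^sub>0(x,a); \<Phi>\<^sub>0(y,b))\<close> compared in the hypothesis on \<open>\<Phi>\<close>.\<close>

definition precontact ::
  "('o, 'm) box_cat \<Rightarrow> ('x, 'o) vgraph \<Rightarrow> ('a, 'o) vgraph \<Rightarrow> ('x \<Rightarrow> 'm) \<Rightarrow> ('a \<Rightarrow> 'm)
    \<Rightarrow> ('y \<Rightarrow> 'y \<Rightarrow> 'y \<Rightarrow> 'm) \<Rightarrow> ('x \<times> 'a, 'y, 'm) transport \<Rightarrow> 'x \<Rightarrow> 'x \<Rightarrow> 'a \<Rightarrow> 'a \<Rightarrow> 'm" where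
  "precontact V X A u v c \<Phi> x y a b =
     contact_direct V (c (vmap \<Phi> (x, a)) (vmap \<Phi> (y, a)) (vmap \<Phi> (y, b)))
       (along_left V X v \<Phi> x y a) (along_right V A u \<Phi> y a b)"

definition postcontact ::
  "('o, 'm) box_cat \<Rightarrow> ('x, 'o) vgraph \<Rightarrow> ('a, 'o) vgraph \<Rightarrow> ('x \<Rightarrow> 'm) \<Rightarrow> ('a \<Rightarrow> 'm)
    \<Rightarrow> ('y \<Rightarrow> 'y \<Rightarrow> 'y \<Rightarrow> 'm) \<Rightarrow> ('x \<times> 'a, 'y, 'm) transport \<Rightarrow> 'x \<Rightarrow> 'x \<Rightarrow> 'a \<Rightarrow> 'a \<Rightarrow> 'm" where
  "postcontact V X A u v c \<Phi> x y a b =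
     contact_crossed V (c (vmap \<Phi> (x, a)) (vmap \<Phi> (x, b)) (vmap \<Phi> (y, b)))
       (along_right V A u \<Phi> x a b) (along_left V X v \<Phi> x y b)"

definition name_vert ::
  "('o, 'm) box_cat \<Rightarrow> ('a, 'o) vgraph \<Rightarrow> ('x \<Rightarrow> 'm) \<Rightarrow> ('x \<times> 'a, 'y, 'm) transport
    \<Rightarrow> 'x \<Rightarrow> ('a, 'y, 'm) transport" where
  "name_vert V A u \<Phi> x = \<lparr>vmap = (\<lambda>a\<in>Vert A. vmap \<Phi> (x, a)),
     emap = (\<lambda>(a, b)\<in>Vert A \<times> Vert A. along_right V A u \<Phi> x a b)\<rparr>"

text \<open>The edge mapping of the name is the arrow into the product with the given components.\<close>

definition name ::
  "('o, 'm) box_cat \<Rightarrow> ('a, 'o, 'm) product_choice \<Rightarrow> ('x, 'o) vgraph \<Rightarrow> ('a, 'o) vgraph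
    \<Rightarrow> ('y, 'o) vgraph \<Rightarrow> ('x \<Rightarrow> 'm) \<Rightarrow> ('a \<Rightarrow> 'm) \<Rightarrow> ('x \<times> 'a, 'y, 'm) transport
    \<Rightarrow> ('x, ('a, 'y, 'm) transport, 'm) transport" where
  "name V P X A Y u v \<Phi> = \<lparr>vmap = (\<lambda>x\<in>Vert X. name_vert V A u \<Phi> x),
     emap = (\<lambda>(x, y)\<in>Vert X \<times> Vert X.
       let fam = edge_family A Y (name_vert V A u \<Phi> x) (name_vert V A u \<Phi> y)
       in THE h. h \<in> hom V (Edge X x y) (Pobj P fam) \<and>
            (\<forall>a\<in>Vert A. Cmp V (Pproj P fam a) h = along_left V X v \<Phi> x y a))\<rparr>"

definition component ::
  "('o, 'm) box_cat \<Rightarrow> ('a, 'o, 'm) product_choice \<Rightarrow> ('a, 'o) vgraph \<Rightarrow> ('y, 'o) vgraph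
    \<Rightarrow> ('x, ('a, 'y, 'm) transport, 'm) transport \<Rightarrow> 'x \<Rightarrow> 'x \<Rightarrow> 'a \<Rightarrow> 'm" where
  "component V P A Y \<Psi> x y a =
     Cmp V (Pproj P (edge_family A Y (vmap \<Psi> x) (vmap \<Psi> y)) a) (emap \<Psi> (x, y))"

definition prerealization ::
  "('o, 'm) box_cat \<Rightarrow> ('a, 'o, 'm) product_choice \<Rightarrow> ('x, 'o) vgraph \<Rightarrow> ('a, 'o) vgraph
    \<Rightarrow> ('y, 'o) vgraph \<Rightarrow> ('y \<Rightarrow> 'y \<Rightarrow> 'y \<Rightarrow> 'm) \<Rightarrow> ('x, ('a, 'y, 'm) transport, 'm) transport
    \<Rightarrow> ('x \<times> 'a, 'y, 'm) transport" where
  "prerealization V P X A Y c \<Psi> =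
    \<lparr>vmap = (\<lambda>(x, a)\<in>Vert X \<times> Vert A. vmap (vmap \<Psi> x) a),
     emap = (\<lambda>((x, a), (y, b))\<in>(Vert X \<times> Vert A) \<times> (Vert X \<times> Vert A).
       contact_direct V
         (c (vmap (vmap \<Psi> x) a) (vmap (vmap \<Psi> y) a) (vmap (vmap \<Psi> y) b))
         (component V P A Y \<Psi> x y a) (emap (vmap \<Psi> y) (a, b)))\<rparr>"

definition postrealization ::
  "('o, 'm) box_cat \<Rightarrow> ('a, 'o, 'm) product_choice \<Rightarrow> ('x, 'o) vgraph \<Rightarrow> ('a, 'o) vgraph
    \<Rightarrow> ('y, 'o) vgraph \<Rightarrow> ('y \<Rightarrow> 'y \<Rightarrow> 'y \<Rightarrow> 'm) \<Rightarrow> ('x, ('a, 'y, 'm) transport, 'm) transport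
    \<Rightarrow> ('x \<times> 'a, 'y, 'm) transport" where
  "postrealization V P X A Y c \<Psi> =
    \<lparr>vmap = (\<lambda>(x, a)\<in>Vert X \<times> Vert A. vmap (vmap \<Psi> x) a),
     emap = (\<lambda>((x, a), (y, b))\<in>(Vert X \<times> Vert A) \<times> (Vert X \<times> Vert A).
       contact_crossed V
         (c (vmap (vmap \<Psi> x) a) (vmap (vmap \<Psi> x) b) (vmap (vmap \<Psi> y) b))
         (emap (vmap \<Psi> x) (a, b)) (component V P A Y \<Psi> x y b))\<rparr>"

definition corestricted_continuous ::
  "('o, 'm) box_cat \<Rightarrow> ('a, 'o, 'm) product_choice \<Rightarrow> ('x, 'o) vgraph \<Rightarrow> ('a, 'o) vgraph
    \<Rightarrow> ('y, 'o) vgraph \<Rightarrow> ('y \<Rightarrow> 'y \<Rightarrow> 'y \<Rightarrow> 'm) \<Rightarrow> ('x, ('a, 'y, 'm) transport, 'm) transport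
    \<Rightarrow> bool" where
  "corestricted_continuous V P X A Y c \<Psi> \<longleftrightarrow>
     (\<forall>x\<in>Vert X. \<forall>y\<in>Vert X. \<forall>a\<in>Vert A. \<forall>b\<in>Vert A.
        Geq V (emap (postrealization V P X A Y c \<Psi>) ((x, a), (y, b)))
              (emap (prerealization V P X A Y c \<Psi>) ((x, a), (y, b))))"

definition corestricted_natural ::
  "('o, 'm) box_cat \<Rightarrow> ('a, 'o, 'm) product_choice \<Rightarrow> ('x, 'o) vgraph \<Rightarrow> ('a, 'o) vgraph
    \<Rightarrow> ('y, 'o) vgraph \<Rightarrow> ('y \<Rightarrow> 'y \<Rightarrow> 'y \<Rightarrow> 'm) \<Rightarrow> ('x, ('a, 'y, 'm) transport, 'm) transport
    \<Rightarrow> bool" where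
  "corestricted_natural V P X A Y c \<Psi> \<longleftrightarrow>
     (\<forall>x\<in>Vert X. \<forall>y\<in>Vert X. \<forall>a\<in>Vert A. \<forall>b\<in>Vert A.
        emap (postrealization V P X A Y c \<Psi>) ((x, a), (y, b)) =
        emap (prerealization V P X A Y c \<Psi>) ((x, a), (y, b)))"

end

theory Submission
  imports Defs
begin

text \<open>
  The name \<open>\<Psi>\<close> of \<open>\<Phi>\<close> splits an edge of \<open>X \<box> A\<close> into its two coordinate directions: the
  transport \<open>\<Psi>\<^sub>0(x)\<close> keeps what \<open>\<Phi>\<close> does in the direction of \<open>A\<close> above \<open>x\<close>, and
  \<open>\<Psi>\<^sub>x\<^sub>,\<^sub>y\<close> keeps what it does in the direction of \<open>X\<close>, for all \<open>a\<close> at once.  The latter is an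
  arrow into a product, so by the universal property it exists and its components are exactly the
  mappings \<open>\<Phi>(X(x;y) \<box> 1\<^sub>a(\<star>))\<close> that define it (\<open>name_edge\<close>).  That \<open>\<Psi>\<close> is a
  transport is then a matter of matching domains and codomains.

  Each realization composes one mapping in each direction by contact.  As the components of
  \<open>\<Psi>\<close> are known, the prerealization and the postrealization of \<open>\<Psi>\<close> are the precontact
  and the postcontact mappings of \<open>\<Phi>\<close> (\<open>emap_realization_name\<close>).  The hypothesis on \<open>\<Phi>\<close>
  thus is the continuity of \<open>\<Psi>\<close>.  Naturality is equality of the two realizations on edges, hence
  equality of transports, since they also agree on vertexes.  If moreover \<open>\<Phi>\<close> lies between the
  postcontact and the precontact mappings, then it lies between two equal mappings, and antisymmetry
  of the order on arrows identifies it with them.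
\<close>

section \<open>Transports\<close>

lemma is_transportI:
  assumes "vmap f \<in> extensional (Vert X)"
    and "emap f \<in> extensional (Vert X \<times> Vert X)"
    and "\<And>x. x \<in> Vert X \<Longrightarrow> vmap f x \<in> Vert Y"
    and "\<And>x y. \<lbrakk>x \<in> Vert X; y \<in> Vert X\<rbrakk>
      \<Longrightarrow> emap f (x, y) \<in> hom V (Edge X x y) (Edge Y (vmap f x) (vmap f y))"
  shows "is_transport V X Y f"
  using assms unfolding is_transport_def by (auto simp: PiE_iff)

lemma is_transport_vmap:
  "\<lbrakk>is_transport V X Y f; x \<in> Vert X\<rbrakk> \<Longrightarrow> vmap f x \<in> Vert Y"
  unfolding is_transport_def by (auto simp: PiE_iff)

lemma is_transport_emap:
  "\<lbrakk>is_transport V X Y f; x \<in> Vert X; y \<in> Vert X\<rbrakk>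
    \<Longrightarrow> emap f (x, y) \<in> hom V (Edge X x y) (Edge Y (vmap f x) (vmap f y))"
  unfolding is_transport_def by (auto simp: PiE_iff)

lemma transport_eqI:
  fixes f g :: "('x, 'y, 'm) transport"
  assumes f: "is_transport V X Y f" and g: "is_transport V X Y g"
    and v: "\<And>x. x \<in> Vert X \<Longrightarrow> vmap f x = vmap g x"
    and e: "\<And>x y. \<lbrakk>x \<in> Vert X; y \<in> Vert X\<rbrakk> \<Longrightarrow> emap f (x, y) = emap g (x, y)"
  shows "f = g"
proof (rule transport.equality)
  show "vmap f = vmap g"
    by (rule extensionalityI[of _ "Vert X"]) (use f g v in \<open>auto simp: is_transport_def PiE_iff\<close>)
  show "emap f = emap g"
    by (rule extensionalityI[of _ "Vert X \<times> Vert X"])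
      (use f g e in \<open>auto simp: is_transport_def PiE_iff\<close>)
qed simp

lemma Vert_box_graph: "Vert (box_graph V X A) = Vert X \<times> Vert A"
  by (simp add: box_graph_def)

lemma Edge_box_graph:
  "Edge (box_graph V X A) (x, a) (y, b) = BoxO V (Edge X x y) (Edge A a b)"
  by (simp add: box_graph_def)

lemma box_graph_emap:
  assumes "is_transport V (box_graph V X A) Y \<Phi>"
    and "x \<in> Vert X" and "y \<in> Vert X" and "a \<in> Vert A" and "b \<in> Vert A"
  shows "emap \<Phi> ((x, a), (y, b)) \<in>
    hom V (BoxO V (Edge X x y) (Edge A a b)) (Edge Y (vmap \<Phi> (x, a)) (vmap \<Phi> (y, b)))"
  using is_transport_emap[OF assms(1), of "(x, a)" "(y, b)"] assms(2-)
  by (simp add: Vert_box_graph Edge_box_graph)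

section \<open>Domains and codomains of the composite mappings\<close>

context ordered_box_category
begin

lemma contact_direct_hom:
  assumes "contact_arrows V Y c" and "k \<in> Vert Y" and "l \<in> Vert Y" and "m \<in> Vert Y"
    and "p \<in> hom V r (Edge Y k l)" and "q \<in> hom V s (Edge Y l m)"
  shows "contact_direct V (c k l m) p q \<in> hom V (r \<box> s) (Edge Y k m)"
proof -
  have "c k l m \<in> hom V (Edge Y k l \<box> Edge Y l m) (Edge Y k m)"
    using assms by (simp add: contact_arrows_def)
  then show ?thesis
    unfolding contact_direct_def using Cmp_hom[OF BoxA_hom[OF assms(5,6)]] by blast
qed

lemma contact_crossed_hom:
  assumes "contact_arrows V Y c" and "k \<in> Vert Y" and "l \<in> Vert Y" and "m \<in> Vert Y"
    and p: "p \<in> hom V r (Edge Y k l)" and q: "q \<in> hom V s (Edge Y l m)"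
  shows "contact_crossed V (c k l m) p q \<in> hom V (s \<box> r) (Edge Y k m)"
proof -
  have dom: "Dm V p = r" "Dm V q = s" and "r \<in> Ob V" "s \<in> Ob V"
    using p q Dm_Ob by (auto simp: hom_def)
  then have "Swap V s r \<in> hom V (s \<box> r) (r \<box> s)"
    using Swap_iso by (simp add: iso_def)
  from Cmp_hom[OF this contact_direct_hom[OF assms]] show ?thesis
    by (simp add: contact_crossed_def contact_direct_def dom)
qed

lemma along_left_hom:
  assumes "is_vgraph V X" and "unit_arrows V A v"
    and "is_transport V (box_graph V X A) Y \<Phi>"
    and "x \<in> Vert X" and "y \<in> Vert X" and "a \<in> Vert A"
  shows "along_left V X v \<Phi> x y a \<in>
    hom V (Edge X x y) (Edge Y (vmap \<Phi> (x, a)) (vmap \<Phi> (y, a)))"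
proof -
  have ob: "Edge X x y \<in> Ob V" using assms by (simp add: is_vgraph_def)
  have "Rins V (Edge X x y) \<in> hom V (Edge X x y) (Edge X x y \<box> \<star>)"
    using Rins_iso[OF ob] by (simp add: iso_def)
  moreover have "Ident V (Edge X x y) \<boxtimes> v a \<in>
      hom V (Edge X x y \<box> \<star>) (Edge X x y \<box> Edge A a a)"
    using BoxA_hom[OF Ident_hom[OF ob]] assms by (simp add: unit_arrows_def)
  ultimately show ?thesis
    unfolding along_left_def using Cmp_hom box_graph_emap[OF assms(3-6,6)] by blast
qed

lemma along_right_hom:
  assumes "is_vgraph V A" and "unit_arrows V X u"
    and "is_transport V (box_graph V X A) Y \<Phi>"
    and "x \<in> Vert X" and "a \<in> Vert A" and "b \<in> Vert A"
  shows "along_right V A u \<Phi> x a b \<in>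
    hom V (Edge A a b) (Edge Y (vmap \<Phi> (x, a)) (vmap \<Phi> (x, b)))"
proof -
  have ob: "Edge A a b \<in> Ob V" using assms by (simp add: is_vgraph_def)
  have "Lins V (Edge A a b) \<in> hom V (Edge A a b) (\<star> \<box> Edge A a b)"
    using Lins_iso[OF ob] by (simp add: iso_def)
  moreover have "u x \<boxtimes> Ident V (Edge A a b) \<in>
      hom V (\<star> \<box> Edge A a b) (Edge X x x \<box> Edge A a b)"
    using BoxA_hom[OF _ Ident_hom[OF ob]] assms by (simp add: unit_arrows_def)
  ultimately show ?thesis
    unfolding along_right_def using Cmp_hom box_graph_emap[OF assms(3,4,4-6)] by blast
qed

lemma Geq_antisym:
  assumes "f \<in> hom V r s" and "g \<in> hom V r s" and "f \<succeq> g" and "g \<succeq> f"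
  shows "f = g"
proof -
  have "r \<in> Ob V" "s \<in> Ob V" using assms(1) Dm_Ob Cd_Ob by (auto simp: hom_def)
  from Geq_partial_order[OF this] show ?thesis
    using assms by (auto simp: partial_order_on_def antisym_def)
qed

section \<open>Realizations of transports into an exponential graph\<close>

lemma component_hom:
  assumes "has_exp_products V P A Y" and \<Psi>: "is_transport V X (exp_graph V P A Y) \<Psi>"
    and "x \<in> Vert X" and "y \<in> Vert X" and "a \<in> Vert A"
  shows "component V P A Y \<Psi> x y a \<in>
    hom V (Edge X x y) (Edge Y (vmap (vmap \<Psi> x) a) (vmap (vmap \<Psi> y) a))"
proof -
  let ?fam = "edge_family A Y (vmap \<Psi> x) (vmap \<Psi> y)"
  have "is_transport V A Y (vmap \<Psi> x)" "is_transport V A Y (vmap \<Psi> y)"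
    using is_transport_vmap[OF \<Psi>] assms(3,4) by (auto simp: exp_graph_def)
  then have "is_product V (Vert A) ?fam (Pobj P ?fam) (Pproj P ?fam)"
    using assms(1) by (simp add: has_exp_products_def)
  then have "Pproj P ?fam a \<in> hom V (Pobj P ?fam) (?fam a)"
    using assms(5) by (simp add: is_product_def)
  moreover have "emap \<Psi> (x, y) \<in> hom V (Edge X x y) (Pobj P ?fam)"
    using is_transport_emap[OF \<Psi> assms(3,4)] by (simp add: exp_graph_def)
  ultimately have "component V P A Y \<Psi> x y a \<in> hom V (Edge X x y) (?fam a)"
    unfolding component_def by (rule Cmp_hom[rotated])
  then show ?thesis using assms(5) by (simp add: edge_family_def)
qed

lemma
  assumes "has_exp_products V P A Y" and "contact_arrows V Y c"
    and \<Psi>: "is_transport V X (exp_graph V P A Y) \<Psi>"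
  shows is_transport_prerealization:
      "is_transport V (box_graph V X A) Y (prerealization V P X A Y c \<Psi>)" (is ?pre)
    and is_transport_postrealization:
      "is_transport V (box_graph V X A) Y (postrealization V P X A Y c \<Psi>)" (is ?post)
proof -
  have tr: "is_transport V A Y (vmap \<Psi> x)" if "x \<in> Vert X" for x
    using is_transport_vmap[OF \<Psi> that] by (simp add: exp_graph_def)
  have vert: "vmap (vmap \<Psi> x) a \<in> Vert Y" if "x \<in> Vert X" "a \<in> Vert A" for x a
    using is_transport_vmap[OF tr] that by blast
  note edge = is_transport_emap[OF tr] component_hom[OF assms(1) \<Psi>]
  show ?pre
    by (rule is_transportI)
      (auto simp: prerealization_def Vert_box_graph Edge_box_graph
        intro!: vert edge contact_direct_hom[OF assms(2)])
  show ?post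
    by (rule is_transportI)
      (auto simp: postrealization_def Vert_box_graph Edge_box_graph
        intro!: vert edge contact_crossed_hom[OF assms(2)])
qed

section \<open>The name of a transport\<close>

lemma is_transport_name_vert:
  assumes "is_vgraph V A" and "unit_arrows V X u"
    and "is_transport V (box_graph V X A) Y \<Phi>" and "x \<in> Vert X"
  shows "is_transport V A Y (name_vert V A u \<Phi> x)"
proof (rule is_transportI)
  fix a assume "a \<in> Vert A"
  then show "vmap (name_vert V A u \<Phi> x) a \<in> Vert Y"
    using is_transport_vmap[OF assms(3), of "(x, a)"] assms(4)
    by (simp add: name_vert_def Vert_box_graph)
qed (use along_right_hom[OF assms] in \<open>simp_all add: name_vert_def\<close>)

text \<open>
  The components prescribed for \<open>\<Psi>\<^sub>x\<^sub>,\<^sub>y\<close> form a cone over the factors of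
  \<open>Y\<^sup>A(\<Psi>\<^sub>0(x);\<Psi>\<^sub>0(y))\<close>, so the description defining \<open>\<Psi>\<^sub>x\<^sub>,\<^sub>y\<close> has a unique
  solution and can be replaced by its two defining properties.
\<close>

lemma name_edge:
  fixes P :: "('a, 'o, 'm) product_choice" and Y :: "('y, 'o) vgraph"
  assumes "is_vgraph V X" and "is_vgraph V A" and "has_exp_products V P A Y"
    and "unit_arrows V X u" and "unit_arrows V A v"
    and "is_transport V (box_graph V X A) Y \<Phi>"
    and x: "x \<in> Vert X" and y: "y \<in> Vert X"
  defines "\<Psi> \<equiv> name V P X A Y u v \<Phi>"
  shows "emap \<Psi> (x, y) \<in>
      hom V (Edge X x y) (Pobj P (edge_family A Y (vmap \<Psi> x) (vmap \<Psi> y)))"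
    and "a \<in> Vert A \<Longrightarrow> component V P A Y \<Psi> x y a = along_left V X v \<Phi> x y a"
proof -
  define fam where "fam = edge_family A Y (name_vert V A u \<Phi> x) (name_vert V A u \<Phi> y)"
  let ?good = "\<lambda>h. h \<in> hom V (Edge X x y) (Pobj P fam) \<and>
    (\<forall>a\<in>Vert A. Pproj P fam a \<cdot> h = along_left V X v \<Phi> x y a)"
  have "is_product V (Vert A) fam (Pobj P fam) (Pproj P fam)"
    using assms(3) is_transport_name_vert[OF assms(2,4,6)] x y
    by (simp add: has_exp_products_def fam_def)
  moreover have "\<forall>a\<in>Vert A. along_left V X v \<Phi> x y a \<in> hom V (Edge X x y) (fam a)"
    using along_left_hom[OF assms(1,5,6) x y]
    by (simp add: fam_def edge_family_def name_vert_def)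
  moreover have "Edge X x y \<in> Ob V"
    using assms(1) x y by (simp add: is_vgraph_def)
  ultimately have "\<exists>!h. ?good h"
    unfolding is_product_def by blast
  then have good: "?good (THE h. ?good h)"
    by (rule theI')
  have vert: "vmap \<Psi> x = name_vert V A u \<Phi> x" "vmap \<Psi> y = name_vert V A u \<Phi> y"
    and edge: "emap \<Psi> (x, y) = (THE h. ?good h)"
    using x y by (simp_all add: \<Psi>_def name_def fam_def Let_def)
  show "emap \<Psi> (x, y) \<in>
      hom V (Edge X x y) (Pobj P (edge_family A Y (vmap \<Psi> x) (vmap \<Psi> y)))"
    using good unfolding vert edge fam_def by blast
  show "component V P A Y \<Psi> x y a = along_left V X v \<Phi> x y a" if "a \<in> Vert A"
    using good that unfolding component_def vert edge fam_def by blast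
qed

lemma is_transport_name:
  fixes P :: "('a, 'o, 'm) product_choice" and Y :: "('y, 'o) vgraph"
  assumes "is_vgraph V X" and "is_vgraph V A" and "has_exp_products V P A Y"
    and "unit_arrows V X u" and "unit_arrows V A v"
    and "is_transport V (box_graph V X A) Y \<Phi>"
  shows "is_transport V X (exp_graph V P A Y) (name V P X A Y u v \<Phi>)"
proof (rule is_transportI)
  let ?\<Psi> = "name V P X A Y u v \<Phi>"
  show "vmap ?\<Psi> \<in> extensional (Vert X)" "emap ?\<Psi> \<in> extensional (Vert X \<times> Vert X)"
    by (simp_all add: name_def)
  show "vmap ?\<Psi> x \<in> Vert (exp_graph V P A Y)" if "x \<in> Vert X" for x
    using is_transport_name_vert[OF assms(2,4,6) that] that by (simp add: name_def exp_graph_def)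
  show "emap ?\<Psi> (x, y) \<in> hom V (Edge X x y) (Edge (exp_graph V P A Y) (vmap ?\<Psi> x) (vmap ?\<Psi> y))"
    if "x \<in> Vert X" "y \<in> Vert X" for x y
    using name_edge(1)[OF assms that] by (simp add: exp_graph_def)
qed

lemma vmap_realization_name:
  assumes "x \<in> Vert X" and "a \<in> Vert A"
  shows "vmap (prerealization V P X A Y c (name V P X A Y u v \<Phi>)) (x, a) = vmap \<Phi> (x, a)"
    and "vmap (postrealization V P X A Y c (name V P X A Y u v \<Phi>)) (x, a) = vmap \<Phi> (x, a)"
  using assms by (simp_all add: prerealization_def postrealization_def name_def name_vert_def)

text \<open>
  The edges of \<open>\<Psi>\<^sub>0(x)\<close> are the mappings of \<open>\<Phi>\<close> along \<open>A\<close> by definition, and the components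
  of \<open>\<Psi>\<^sub>x\<^sub>,\<^sub>y\<close> those along \<open>X\<close> by the universal property; the realizations and the contact
  mappings of \<open>\<Phi>\<close> compose them in the same order.
\<close>

lemma emap_realization_name:
  fixes P :: "('a, 'o, 'm) product_choice" and Y :: "('y, 'o) vgraph"
  assumes "is_vgraph V X" and "is_vgraph V A" and "has_exp_products V P A Y"
    and "unit_arrows V X u" and "unit_arrows V A v"
    and "is_transport V (box_graph V X A) Y \<Phi>"
    and xy: "x \<in> Vert X" "y \<in> Vert X" and ab: "a \<in> Vert A" "b \<in> Vert A"
  defines "\<Psi> \<equiv> name V P X A Y u v \<Phi>"
  shows "emap (prerealization V P X A Y c \<Psi>) ((x, a), (y, b)) = precontact V X A u v c \<Phi> x y a b"
    and "emap (postrealization V P X A Y c \<Psi>) ((x, a), (y, b)) = postcontact V X A u v c \<Phi> x y a b"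
proof -
  have comp: "component V P A Y \<Psi> x y d = along_left V X v \<Phi> x y d" if "d \<in> Vert A" for d
    unfolding \<Psi>_def by (rule name_edge(2)[OF assms(1-6) xy that])
  have vert: "vmap \<Psi> z = name_vert V A u \<Phi> z" if "z \<in> Vert X" for z
    using that by (simp add: \<Psi>_def name_def)
  show "emap (prerealization V P X A Y c \<Psi>) ((x, a), (y, b)) = precontact V X A u v c \<Phi> x y a b"
    using xy ab by (simp add: prerealization_def precontact_def comp vert name_vert_def)
  show "emap (postrealization V P X A Y c \<Psi>) ((x, a), (y, b)) = postcontact V X A u v c \<Phi> x y a b"
    using xy ab by (simp add: postrealization_def postcontact_def comp vert name_vert_def)
qed

end

section \<open>Continuity of the name and recovery of the transport\<close>

theorem proposition12:
  fixes V :: "('o, 'm) box_cat"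
    and P :: "('a, 'o, 'm) product_choice"
    and X :: "('x, 'o) vgraph" and A :: "('a, 'o) vgraph" and Y :: "('y, 'o) vgraph"
    and u :: "'x \<Rightarrow> 'm" and v :: "'a \<Rightarrow> 'm" and c :: "'y \<Rightarrow> 'y \<Rightarrow> 'y \<Rightarrow> 'm"
    and \<Phi> :: "('x \<times> 'a, 'y, 'm) transport"
    and \<Psi> :: "('x, ('a, 'y, 'm) transport, 'm) transport"
  assumes "ordered_box_category V"
    and "is_vgraph V X" and "is_vgraph V A" and "is_vgraph V Y"
    and "has_exp_products V P A Y"
    and "unit_arrows V X u" and "unit_arrows V A v"
    and "contact_arrows V Y c"
    and "is_transport V (box_graph V X A) Y \<Phi>"
    and "\<And>x y a b. \<lbrakk>x \<in> Vert X; y \<in> Vert X; a \<in> Vert A; b \<in> Vert A\<rbrakk> \<Longrightarrow>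
           postcontact V X A u v c \<Phi> x y a b \<succeq>\<^bsub>V\<^esub> precontact V X A u v c \<Phi> x y a b"
    and "\<Psi> = name V P X A Y u v \<Phi>"
  shows "is_transport V X (exp_graph V P A Y) \<Psi> \<and>
    corestricted_continuous V P X A Y c \<Psi> \<and>
    is_transport V (box_graph V X A) Y (prerealization V P X A Y c \<Psi>) \<and>
    is_transport V (box_graph V X A) Y (postrealization V P X A Y c \<Psi>) \<and>
    (\<forall>x\<in>Vert X. \<forall>a\<in>Vert A.
       vmap (prerealization V P X A Y c \<Psi>) (x, a) = vmap \<Phi> (x, a) \<and>
       vmap (postrealization V P X A Y c \<Psi>) (x, a) = vmap \<Phi> (x, a)) \<and>
    (\<forall>x\<in>Vert X. \<forall>y\<in>Vert X. \<forall>a\<in>Vert A. \<forall>b\<in>Vert A.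
       emap (prerealization V P X A Y c \<Psi>) ((x, a), (y, b)) = precontact V X A u v c \<Phi> x y a b \<and>
       emap (postrealization V P X A Y c \<Psi>) ((x, a), (y, b)) = postcontact V X A u v c \<Phi> x y a b) \<and>
    (corestricted_natural V P X A Y c \<Psi> \<longrightarrow>
       prerealization V P X A Y c \<Psi> = postrealization V P X A Y c \<Psi> \<and>
       ((\<forall>x\<in>Vert X. \<forall>y\<in>Vert X. \<forall>a\<in>Vert A. \<forall>b\<in>Vert A.
           postcontact V X A u v c \<Phi> x y a b \<succeq>\<^bsub>V\<^esub> emap \<Phi> ((x, a), (y, b)) \<and>
           emap \<Phi> ((x, a), (y, b)) \<succeq>\<^bsub>V\<^esub> precontact V X A u v c \<Phi> x y a b) \<longrightarrow>
        prerealization V P X A Y c \<Psi> = \<Phi>))"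
proof -
  interpret ordered_box_category V by fact
  let ?pre = "prerealization V P X A Y c \<Psi>" and ?post = "postrealization V P X A Y c \<Psi>"
  have name: "is_transport V X (exp_graph V P A Y) \<Psi>"
    unfolding \<open>\<Psi> = _\<close> by (rule is_transport_name) fact+
  have pre: "is_transport V (box_graph V X A) Y ?pre"
    and post: "is_transport V (box_graph V X A) Y ?post"
    using is_transport_prerealization is_transport_postrealization assms(5,8) name by blast+
  have vert: "vmap ?pre (x, a) = vmap \<Phi> (x, a) \<and> vmap ?post (x, a) = vmap \<Phi> (x, a)"
    if "x \<in> Vert X" "a \<in> Vert A" for x a
    unfolding \<open>\<Psi> = _\<close> by (simp add: vmap_realization_name that)
  have edge: "emap ?pre ((x, a), (y, b)) = precontact V X A u v c \<Phi> x y a b \<and>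
      emap ?post ((x, a), (y, b)) = postcontact V X A u v c \<Phi> x y a b"
    if "x \<in> Vert X" "y \<in> Vert X" "a \<in> Vert A" "b \<in> Vert A" for x y a b
    using emap_realization_name[OF assms(2,3,5-7,9) that] \<open>\<Psi> = _\<close> by simp
  have continuous: "corestricted_continuous V P X A Y c \<Psi>"
    using edge assms(10) by (simp add: corestricted_continuous_def)
  have coincide: "?pre = ?post" if "corestricted_natural V P X A Y c \<Psi>"
    by (rule transport_eqI[OF pre post])
      (use that vert in \<open>auto simp: corestricted_natural_def Vert_box_graph\<close>)
  have recover: "?pre = \<Phi>"
    if natural: "corestricted_natural V P X A Y c \<Psi>"
      and between: "\<forall>x\<in>Vert X. \<forall>y\<in>Vert X. \<forall>a\<in>Vert A. \<forall>b\<in>Vert A.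
        postcontact V X A u v c \<Phi> x y a b \<succeq>\<^bsub>V\<^esub> emap \<Phi> ((x, a), (y, b)) \<and>
        emap \<Phi> ((x, a), (y, b)) \<succeq>\<^bsub>V\<^esub> precontact V X A u v c \<Phi> x y a b"
  proof (rule transport_eqI[OF pre assms(9)])
    fix p q assume pq: "p \<in> Vert (box_graph V X A)" "q \<in> Vert (box_graph V X A)"
    then obtain x a y b where
      [simp]: "p = (x, a)" "q = (y, b)" and
      mem: "x \<in> Vert X" "y \<in> Vert X" "a \<in> Vert A" "b \<in> Vert A"
      by (auto simp: Vert_box_graph)
    \<comment> \<open>The two ends of the chain around \<open>\<Phi>\<close> are the same mapping.\<close>
    have "emap ?pre (p, q) = emap ?post (p, q)"
      using coincide[OF natural] by simp
    then have "emap ?pre (p, q) \<succeq>\<^bsub>V\<^esub> emap \<Phi> (p, q)" "emap \<Phi> (p, q) \<succeq>\<^bsub>V\<^esub> emap ?pre (p, q)"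
      using between[rule_format, OF mem] edge[OF mem] by simp_all
    moreover have "emap ?pre (p, q) \<in>
        hom V (Edge (box_graph V X A) p q) (Edge Y (vmap \<Phi> p) (vmap \<Phi> q))"
      using is_transport_emap[OF pre pq] vert mem by simp
    ultimately show "emap ?pre (p, q) = emap \<Phi> (p, q)"
      using Geq_antisym is_transport_emap[OF assms(9) pq] by blast
  qed (use vert in \<open>auto simp: Vert_box_graph\<close>)
  show ?thesis
    using name continuous pre post vert edge coincide recover by blast
qed

end
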